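(* Let $V$ be a finite-dimensional real inner product space and let $T\colon V\to V$ be a locally Lipschitz operator with nonempty fixed point set $\operatorname{Fix}T$ that is demi-contractive, i.e. $$\|Tx-\bar x\|^2\le\|x-\bar x\|^2+\|x-Tx\|^2\qquad\forall x\in V,\ \forall\bar x\in\operatorname{Fix}T.$$ Define $F=\operatorname{Id}-T$. Let $\varphi=\frac{\sqrt5+1}{2}$, and choose $x^0,x^1\in V$, $\lambda_0>0$, $\phi\in(1,\varphi]$, $\bar\lambda>0$; set $\bar x^0=x^1$, $\theta_0=1$, $\rho=\frac1\phi+\frac1{\phi^2}$, and for $k\ge1$ let $$\lambda_k=\min\Bigl\{\rho\lambda_{k-1},\ \frac{\phi\,\theta_{k-1}}{4\lambda_{k-1}}\frac{\|x^k-x^{k-1}\|^2}{\|F(x^k)-F(x^{k-1})\|^2},\ \bar\lambda\Bigr\},$$ $$\bar x^k=\frac{(\phi-1)x^k+\bar x^{k-1}}{\phi},\qquad x^{k+1}=\Bigl(\frac{\phi-1}{\phi}-\lambda_k\Bigr)x^k+\frac1\phi\bar x^{k-1}+\lambda_kTx^k,\qquad \theta_k=\phi\,\frac{\lambda_k}{\lambda_{k-1}}.$$ Then the sequence $(x^k)$ converges to a fixed point of $T$.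
   Context: $\|\cdot\|$ is the norm induced by the inner product of $V$, and $\operatorname{Fix}T=\{x\in V:Tx=x\}$. In the formula for $\lambda_k$, a quotient with zero denominator (including $\frac00$) is taken to be $+\infty$. *)

theory Defs
  imports "HOL-Analysis.Analysis"
begin

definition Fix :: "('a \<Rightarrow> 'a) \<Rightarrow> 'a set" where
  "Fix T = {x. T x = x}"

(* The library constant local_lipschitz concerns families of maps indexed by a metric
   parameter space; this is its version for a single map on the whole space. *)
definition locally_lipschitz :: "('a::metric_space \<Rightarrow> 'b::metric_space) \<Rightarrow> bool" where
  "locally_lipschitz f \<longleftrightarrow> (\<forall>x. \<exists>u>0. \<exists>L. lipschitz_on L (cball x u) f)"

definition demi_contractive :: "('a::real_normed_vector \<Rightarrow> 'a) \<Rightarrow> bool" where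
  "demi_contractive T \<longleftrightarrow>
     (\<forall>x. \<forall>z\<in>Fix T. (norm (T x - z))\<^sup>2 \<le> (norm (x - z))\<^sup>2 + (norm (x - T x))\<^sup>2)"

(* Division on ereal gives 0 / 0 = 0, whereas here every quotient with zero denominator,
   including 0 / 0, is infinite. *)
definition ext_quotient :: "real \<Rightarrow> real \<Rightarrow> ereal" where
  "ext_quotient a b = (if b = 0 then \<infinity> else ereal (a / b))"

end

theory Submission
  imports Defs
begin

text \<open>
  Demi-contractivity says exactly that \<open>F\<close> is monotone towards the fixed points:
  \<open>F v \<bullet> (v - z) \<ge> 0\<close> for every fixed point \<open>z\<close>. For each such \<open>z\<close> this makes the energy
  \<open>\<phi> / (\<phi> - 1) * (norm (xbar k - z))\<^sup>2 + \<theta> (k - 1) / 2 * (norm (x k - x (k - 1)))\<^sup>2\<close>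
  decrease by at least \<open>\<theta> k * (norm (x k - xbar k))\<^sup>2\<close> per step, from \<open>k = 2\<close> on (\<open>x 1\<close> does not
  arise from an iteration step). Hence the iterates stay in a compact ball, where \<open>F\<close> is
  Lipschitz, so the step sizes are bounded away from \<open>0\<close>. It follows that \<open>x k - xbar k\<close>, and then
  \<open>F (x k)\<close>, tends to \<open>0\<close>, so every cluster point is a fixed point. The energy with respect to a
  cluster point tends to \<open>0\<close> along a subsequence, hence along the whole sequence.
\<close>

section \<open>Compactness of closed balls in finite dimension\<close>

lemma orthogonal_expansion:
  fixes C :: "'a::real_inner set"
  assumes fin: "finite C" and span: "span C = UNIV"
    and orth: "pairwise orthogonal C" and nz: "0 \<notin> C"
  shows "(\<Sum>c\<in>C. (v \<bullet> c / (c \<bullet> c)) *\<^sub>R c) = v"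
proof -
  \<comment> \<open>The residual \<open>y\<close> is orthogonal to every member of \<open>C\<close>,
    hence to \<open>span C = UNIV\<close> and so to itself; it must vanish.\<close>
  define y where "y = v - (\<Sum>c\<in>C. (v \<bullet> c / (c \<bullet> c)) *\<^sub>R c)"
  have "orthogonal y d" if d: "d \<in> C" for d
  proof -
    have "(\<Sum>c\<in>C. (v \<bullet> c / (c \<bullet> c)) * (c \<bullet> d)) = (\<Sum>c\<in>C. if c = d then v \<bullet> d else 0)"
      using orth d nz by (intro sum.cong refl) (auto simp: pairwise_def orthogonal_def)
    also have "\<dots> = v \<bullet> d"
      using fin d by simp
    finally show ?thesis
      by (simp add: y_def orthogonal_def inner_diff_left inner_sum_left)
  qed
  then have "orthogonal y y"
    using orthogonal_to_span[of y C y] span by auto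
  then show ?thesis
    by (simp add: y_def orthogonal_self)
qed

text \<open>Finite dimension is given only by a finite spanning set, so the argument runs through
  coordinates in an orthogonal basis: a bounded sequence has a subsequence along which all of the
  finitely many coordinates converge, and the expansion turns this into convergence of the
  vectors.\<close>

lemma finite_dim_compact_cball:
  fixes a :: "'a::real_inner"
  assumes "\<exists>B::'a set. finite B \<and> span B = UNIV"
  shows "compact (cball a r)"
proof -
  obtain C0 :: "'a set" where C0: "finite C0" "span C0 = UNIV" "pairwise orthogonal C0"
    using assms basis_orthogonal by metis
  \<comment> \<open>Dropping 0 keeps the span and makes every divisor \<open>c \<bullet> c\<close>
    nonzero.\<close>
  define C where "C = C0 - {0}"
  have fin: "finite C" and span: "span C = UNIV" and orth: "pairwise orthogonal C"
    and nz: "0 \<notin> C"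
    using C0 by (auto simp: C_def pairwise_def span_delete_0)
  have expand: "(\<Sum>c\<in>C. (v \<bullet> c / (c \<bullet> c)) *\<^sub>R c) = v" for v
    by (rule orthogonal_expansion[OF fin span orth nz])
  have coord: "(\<Sum>c\<in>C. e c *\<^sub>R c) \<bullet> d / (d \<bullet> d) = e d" if d: "d \<in> C" for e :: "'a \<Rightarrow> real" and d
  proof -
    have "(\<Sum>c\<in>C. e c * (c \<bullet> d)) = (\<Sum>c\<in>C. if c = d then e d * (d \<bullet> d) else 0)"
      using orth d by (intro sum.cong refl) (auto simp: pairwise_def orthogonal_def)
    then show ?thesis
      using fin d nz by (auto simp: inner_sum_left)
  qed
  show ?thesis
    unfolding compact_eq_seq_compact_metric seq_compact_def
  proof (intro allI impI)
    fix f :: "nat \<Rightarrow> 'a" assume f: "\<forall>n. f n \<in> cball a r"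
    then have bdd: "bounded (range f)"
      by (meson bounded_cball bounded_subset image_subset_iff)
    have bproj: "bounded ((\<lambda>v. v \<bullet> c / (c \<bullet> c)) ` range f)" for c
      by (rule bounded_linear_image[OF bdd])
        (auto intro!: bounded_linear_intros simp: divide_inverse)
    have "\<forall>D\<subseteq>C. \<exists>l. \<exists>s::nat \<Rightarrow> nat. strict_mono s \<and> (\<forall>e>0. \<forall>\<^sub>F n in sequentially.
        \<forall>c\<in>D. dist (f (s n) \<bullet> c / (c \<bullet> c)) (l \<bullet> c / (c \<bullet> c)) < e)"
      by (rule compact_lemma_general[where proj = "\<lambda>v c. v \<bullet> c / (c \<bullet> c)"
          and unproj = "\<lambda>e. \<Sum>c\<in>C. e c *\<^sub>R c", OF fin bproj coord expand])
    then obtain l and s :: "nat \<Rightarrow> nat" where s: "strict_mono s" and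
      ev: "\<And>e. e > 0 \<Longrightarrow> \<forall>\<^sub>F n in sequentially. \<forall>c\<in>C.
        dist (f (s n) \<bullet> c / (c \<bullet> c)) (l \<bullet> c / (c \<bullet> c)) < e"
      by blast
    have "(\<lambda>n. f (s n) \<bullet> c / (c \<bullet> c)) \<longlonglongrightarrow> l \<bullet> c / (c \<bullet> c)" if "c \<in> C" for c
      using ev that by (intro tendstoI) (fast elim: eventually_mono)
    then have "(\<lambda>n. \<Sum>c\<in>C. (f (s n) \<bullet> c / (c \<bullet> c)) *\<^sub>R c)
        \<longlonglongrightarrow> (\<Sum>c\<in>C. (l \<bullet> c / (c \<bullet> c)) *\<^sub>R c)"
      by (intro tendsto_sum tendsto_scaleR tendsto_const) auto
    then have lim: "(f \<circ> s) \<longlonglongrightarrow> l"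
      by (simp add: expand o_def)
    moreover have "l \<in> cball a r"
      using lim f by (intro closed_sequentially[OF closed_cball _ lim]) auto
    ultimately show "\<exists>l\<in>cball a r. \<exists>s. strict_mono s \<and> (f \<circ> s) \<longlonglongrightarrow> l"
      using s by blast
  qed
qed

section \<open>Consequences of the assumptions on the operator and the step sizes\<close>

lemma locally_lipschitz_compact_imp_lipschitz:
  fixes f :: "'a::metric_space \<Rightarrow> 'b::metric_space"
  assumes "locally_lipschitz f" "compact K"
  obtains L where "L-lipschitz_on K f"
proof -
  \<comment> \<open>The single map is viewed as a family over the one-point parameter space
    \<open>{0}\<close>, to which the compactness theorem for such families applies.\<close>
  have "local_lipschitz {0::real} K (\<lambda>_. f)"
    unfolding local_lipschitz_def
  proof (intro ballI)
    fix a t assume "a \<in> K"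
    obtain u L where u: "u > 0" "L-lipschitz_on (cball a u) f"
      using assms unfolding locally_lipschitz_def by blast
    then show "\<exists>u>0. \<exists>L. \<forall>t\<in>cball t u \<inter> {0::real}. L-lipschitz_on (cball a u \<inter> K) f"
      by (meson inf_le1 lipschitz_on_subset)
  qed
  then show thesis
    using local_lipschitz_compact_implies_lipschitz[of "{0::real}" K "\<lambda>_. f"] assms(2) that
    by auto
qed

text \<open>Write \<open>T v - z\<close> as \<open>(v - z) - (v - T v)\<close> and expand its
  square: both squared norms on the right cancel, and only the inner product remains.\<close>

lemma demi_contractive_inner_nonneg:
  fixes T :: "'a::real_inner \<Rightarrow> 'a"
  assumes "demi_contractive T" "z \<in> Fix T"
  shows "(v - T v) \<bullet> (v - z) \<ge> 0"
proof -
  have "(norm (T v - z))\<^sup>2 \<le> (norm (v - z))\<^sup>2 + (norm (v - T v))\<^sup>2"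
    using assms unfolding demi_contractive_def by blast
  then show ?thesis
    by (simp add: power2_norm_eq_inner inner_diff_left inner_diff_right inner_commute)
qed

text \<open>Moves the rule from \<open>ereal\<close> to the reals. The product form of the third
  bound also covers \<open>d = 0\<close>, and a finite minimum cannot be attained at an infinite
  quotient.\<close>

lemma step_size_min:
  assumes l: "ereal l = Min {ereal r, ext_quotient a b * ext_quotient c d, ereal m}"
    and "a > 0" "b > 0" "c \<ge> 0" "d \<ge> 0"
  shows "l \<le> r" "l \<le> m" "l * d \<le> a / b * c"
    and "l = r \<or> l = m \<or> d > 0 \<and> l = a / b * (c / d)"
proof -
  let ?S = "{ereal r, ext_quotient a b * ext_quotient c d, ereal m}"
  have le: "ereal l \<le> s" if "s \<in> ?S" for s
    unfolding l by (rule Min_le) (use that in auto)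
  show "l \<le> r" "l \<le> m"
    using le[of "ereal r"] le[of "ereal m"] by auto
  \<comment> \<open>Positivity of \<open>a / b\<close> matters for \<open>d = 0\<close>: in
    \<open>ereal\<close>, zero times infinity would be zero.\<close>
  have q: "ext_quotient a b * ext_quotient c d = (if d = 0 then \<infinity> else ereal (a / b * (c / d)))"
    using assms by (auto simp: ext_quotient_def)
  have "l \<le> a / b * (c / d)" if "d \<noteq> 0"
    using le[of "ext_quotient a b * ext_quotient c d"] that unfolding q by simp
  then show "l * d \<le> a / b * c"
    using assms(2-) by (cases "d = 0") (auto simp: field_simps)
  have "ereal l \<in> ?S"
    unfolding l by (rule Min_in) auto
  then show "l = r \<or> l = m \<or> d > 0 \<and> l = a / b * (c / d)"
    using assms(5) unfolding q by (auto split: if_splits)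
qed

section \<open>Energy decrease in one step\<close>

text \<open>Here \<open>u\<close>, \<open>v\<close>, \<open>w\<close> are three consecutive iterates, \<open>b\<close> and \<open>b'\<close> the averages
  belonging to \<open>v\<close> and \<open>w\<close>, and \<open>Fu\<close>, \<open>Fv\<close> the values of the operator.\<close>

lemma golden_ratio_step:
  fixes u v w b b' z Fu Fv :: "'a::real_inner"
  assumes \<phi>: "\<phi> > 1" and l: "l > 0" "l0 > 0"
    and w: "w = b - l *\<^sub>R Fv"
    and v: "\<phi> *\<^sub>R (v - b) = - (l0 *\<^sub>R Fu)"
    and b': "b' = ((\<phi> - 1) *\<^sub>R w + b) /\<^sub>R \<phi>"
    and \<theta>: "\<theta> = \<phi> * (l / l0)" "\<theta> \<le> 1 + 1 / \<phi>" "\<theta>' > 0"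
    and lip: "l\<^sup>2 * (norm (Fv - Fu))\<^sup>2 \<le> \<theta> * \<theta>' / 4 * (norm (v - u))\<^sup>2"
    and mono: "Fv \<bullet> (v - z) \<ge> 0"
  shows "\<phi> / (\<phi> - 1) * (norm (b' - z))\<^sup>2 + \<theta> / 2 * (norm (w - v))\<^sup>2 + \<theta> * (norm (v - b))\<^sup>2
    \<le> \<phi> / (\<phi> - 1) * (norm (b - z))\<^sup>2 + \<theta>' / 2 * (norm (v - u))\<^sup>2"
proof -
  have "\<theta> > 0"
    using \<phi> l \<theta>(1) by simp
  \<comment> \<open>Since \<open>b'\<close> is a convex combination of \<open>w\<close> and
    \<open>b\<close> with weights \<open>1 - 1 / \<phi>\<close> and \<open>1 / \<phi>\<close>, this
    is the identity for the squared norm of a convex combination, scaled by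
    \<open>\<phi> / (\<phi> - 1)\<close>.\<close>
  have avg: "\<phi> / (\<phi> - 1) * (norm (b' - z))\<^sup>2
      = (norm (w - z))\<^sup>2 + 1 / (\<phi> - 1) * (norm (b - z))\<^sup>2 - 1 / \<phi> * (norm (w - b))\<^sup>2"
  proof -
    define p q r where "p = w - z" and "q = b - z" and "r = b' - z"
    have "\<phi> *\<^sub>R r = (\<phi> - 1) *\<^sub>R p + q"
      using \<phi> by (simp add: b' p_def q_def r_def algebra_simps)
    then have "(norm (\<phi> *\<^sub>R r))\<^sup>2 = (norm ((\<phi> - 1) *\<^sub>R p + q))\<^sup>2"
      by simp
    then have "\<phi>\<^sup>2 * (norm r)\<^sup>2 = (\<phi> - 1)\<^sup>2 * (norm p)\<^sup>2 + (\<phi> - 1) * (2 * (p \<bullet> q)) + (norm q)\<^sup>2"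
      unfolding power2_norm_eq_inner
      by (simp add: inner_add_left inner_add_right inner_commute power2_eq_square)
    moreover have "2 * (p \<bullet> q) = (norm p)\<^sup>2 + (norm q)\<^sup>2 - (norm (w - b))\<^sup>2"
      by (simp add: p_def q_def power2_norm_eq_inner inner_diff_left inner_diff_right inner_commute)
    ultimately have "\<phi>\<^sup>2 * (norm (b' - z))\<^sup>2 = (\<phi> - 1)\<^sup>2 * (norm (w - z))\<^sup>2
        + (\<phi> - 1) * ((norm (w - z))\<^sup>2 + (norm (b - z))\<^sup>2 - (norm (w - b))\<^sup>2)
        + (norm (b - z))\<^sup>2"
      unfolding p_def q_def r_def by simp
    also have "\<dots> = \<phi> * (\<phi> - 1) * (norm (w - z))\<^sup>2 + \<phi> * (norm (b - z))\<^sup>2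
        - (\<phi> - 1) * (norm (w - b))\<^sup>2"
      by (simp add: power2_eq_square algebra_simps)
    finally have eq: "\<phi>\<^sup>2 * (norm (b' - z))\<^sup>2 = \<dots>" .
    have "\<phi> / (\<phi> - 1) * (norm (b' - z))\<^sup>2 = \<phi>\<^sup>2 * (norm (b' - z))\<^sup>2 / (\<phi> * (\<phi> - 1))"
      using \<phi> by (simp add: power2_eq_square)
    also have "\<dots> = (norm (w - z))\<^sup>2 + 1 / (\<phi> - 1) * (norm (b - z))\<^sup>2 - 1 / \<phi> * (norm (w - b))\<^sup>2"
      unfolding eq using \<phi> by (simp add: add_divide_distrib diff_divide_distrib)
    finally show ?thesis .
  qed
  have Fu: "l *\<^sub>R Fu = - (\<theta> *\<^sub>R (v - b))"
  proof -
    have "\<theta> *\<^sub>R (v - b) = (l / l0) *\<^sub>R (\<phi> *\<^sub>R (v - b))"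
      by (simp add: \<theta>(1))
    then show ?thesis
      using l unfolding v by simp
  qed
  \<comment> \<open>Split \<open>w - z\<close> into \<open>(w - v) + (v - z)\<close>, and
    \<open>Fv\<close> into \<open>(Fv - Fu) + Fu\<close> in the part with \<open>w - v\<close>. The
    \<open>v - z\<close> part has a favourable sign by \<open>mono\<close>.\<close>
  have "(w - b) \<bullet> (w - z) = - (l * (Fv \<bullet> (v - z))) - l * ((Fv - Fu) \<bullet> (w - v)) - (l *\<^sub>R Fu) \<bullet> (w - v)"
    by (simp add: w algebra_simps inner_diff_left inner_diff_right)
  also have "\<dots> \<le> - (l * ((Fv - Fu) \<bullet> (w - v))) + \<theta> * ((v - b) \<bullet> (w - v))"
    using mono l unfolding Fu by simp
  finally have "2 * ((w - b) \<bullet> (w - z)) \<le> - (2 * (l * ((Fv - Fu) \<bullet> (w - v)))) + \<theta> * (2 * ((v - b) \<bullet> (w - v)))"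
    by simp
  moreover have "2 * ((v - b) \<bullet> (w - v)) = (norm (w - b))\<^sup>2 - (norm (w - v))\<^sup>2 - (norm (v - b))\<^sup>2"
    by (simp add: power2_norm_eq_inner inner_diff_left inner_diff_right inner_commute)
  moreover have "(norm (w - z))\<^sup>2 = (norm (b - z))\<^sup>2 - (norm (w - b))\<^sup>2 + 2 * ((w - b) \<bullet> (w - z))"
    by (simp add: power2_norm_eq_inner inner_diff_left inner_diff_right inner_commute)
  moreover have "- (2 * (l * ((Fv - Fu) \<bullet> (w - v)))) \<le> \<theta> / 2 * (norm (w - v))\<^sup>2 + \<theta>' / 2 * (norm (v - u))\<^sup>2"
  proof -
    define A m d where "A = l * norm (Fv - Fu)" and "m = norm (w - v)" and "d = norm (v - u)"
    have "- ((Fv - Fu) \<bullet> (w - v)) \<le> norm (Fv - Fu) * norm (w - v)"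
      using Cauchy_Schwarz_ineq2[of "Fv - Fu" "w - v"] by linarith
    then have "l * - ((Fv - Fu) \<bullet> (w - v)) \<le> l * (norm (Fv - Fu) * norm (w - v))"
      using l by (intro mult_left_mono) auto
    then have "- (2 * (l * ((Fv - Fu) \<bullet> (w - v)))) \<le> 2 * A * m"
      by (simp add: A_def m_def)
    \<comment> \<open>Young's inequality, checked on squares through
      \<open>4 * p * q = (p + q)^2 - (p - q)^2\<close>; the factor 1/4 in \<open>lip\<close> makes
      the constants match.\<close>
    also have "2 * A * m \<le> \<theta> / 2 * m\<^sup>2 + \<theta>' / 2 * d\<^sup>2"
    proof (rule power2_le_imp_le)
      have "(2 * A * m)\<^sup>2 = 4 * A\<^sup>2 * m\<^sup>2"
        by (simp add: power_mult_distrib)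
      also have "\<dots> \<le> 4 * (\<theta> * \<theta>' / 4 * d\<^sup>2) * m\<^sup>2"
        using lip by (intro mult_right_mono mult_left_mono) (auto simp: A_def d_def power_mult_distrib)
      also have "\<dots> = (\<theta> / 2 * m\<^sup>2 + \<theta>' / 2 * d\<^sup>2)\<^sup>2 - (\<theta> / 2 * m\<^sup>2 - \<theta>' / 2 * d\<^sup>2)\<^sup>2"
        by (simp add: power2_eq_square algebra_simps)
      also have "\<dots> \<le> (\<theta> / 2 * m\<^sup>2 + \<theta>' / 2 * d\<^sup>2)\<^sup>2"
        by simp
      finally show "(2 * A * m)\<^sup>2 \<le> (\<theta> / 2 * m\<^sup>2 + \<theta>' / 2 * d\<^sup>2)\<^sup>2" .
    qed (use \<open>\<theta> > 0\<close> \<theta>(3) in auto)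
    finally show ?thesis
      by (simp add: m_def d_def)
  qed
  \<comment> \<open>The bound on \<open>\<theta>\<close> lets the negative multiples of
    \<open>(norm (w - b))^2\<close>, with coefficients 1 and \<open>1 / \<phi>\<close>, absorb the
    positive one.\<close>
  moreover have "\<theta> * (norm (w - b))\<^sup>2 \<le> (norm (w - b))\<^sup>2 + 1 / \<phi> * (norm (w - b))\<^sup>2"
    using mult_right_mono[OF \<theta>(2), of "(norm (w - b))\<^sup>2"] by (simp add: distrib_right)
  moreover have "\<phi> / (\<phi> - 1) * (norm (b - z))\<^sup>2 = (norm (b - z))\<^sup>2 + 1 / (\<phi> - 1) * (norm (b - z))\<^sup>2"
    using \<phi> by (simp add: field_simps)
  ultimately show ?thesis
    using avg by (simp add: right_diff_distrib)
qed

theorem theorem4: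
  fixes T F :: "'a::real_inner \<Rightarrow> 'a"
    and x xbar :: "nat \<Rightarrow> 'a"
    and lam \<theta> :: "nat \<Rightarrow> real"
    and \<phi> \<rho> lambar :: real
  assumes fin_dim: "\<exists>B::'a set. finite B \<and> span B = UNIV"
    and lip: "locally_lipschitz T"
    and fix_ne: "Fix T \<noteq> {}"
    and demi: "demi_contractive T"
    and F: "\<And>v. F v = v - T v"
    and lam0: "lam 0 > 0"
    and phi: "1 < \<phi>" "\<phi> \<le> (sqrt 5 + 1) / 2"
    and lambar: "lambar > 0"
    and xbar0: "xbar 0 = x 1"
    and theta0: "\<theta> 0 = 1"
    and rho: "\<rho> = 1 / \<phi> + 1 / \<phi>\<^sup>2"
    and lam: "\<And>k. k \<ge> 1 \<Longrightarrow>
      ereal (lam k) =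
        Min {ereal (\<rho> * lam (k - 1)),
             ext_quotient (\<phi> * \<theta> (k - 1)) (4 * lam (k - 1)) *
               ext_quotient ((norm (x k - x (k - 1)))\<^sup>2) ((norm (F (x k) - F (x (k - 1))))\<^sup>2),
             ereal lambar}"
    and xbar: "\<And>k. k \<ge> 1 \<Longrightarrow>
      xbar k = ((\<phi> - 1) *\<^sub>R x k + xbar (k - 1)) /\<^sub>R \<phi>"
    and x: "\<And>k. k \<ge> 1 \<Longrightarrow>
      x (k + 1) = ((\<phi> - 1) / \<phi> - lam k) *\<^sub>R x k + (1 / \<phi>) *\<^sub>R xbar (k - 1) + lam k *\<^sub>R T (x k)"
    and theta: "\<And>k. k \<ge> 1 \<Longrightarrow> \<theta> k = \<phi> * (lam k / lam (k - 1))"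
  shows "\<exists>p\<in>Fix T. x \<longlonglongrightarrow> p"
proof -
  obtain z0 where z0: "z0 \<in> Fix T"
    using fix_ne by blast
  \<comment> \<open>The golden ratio is the positive root of \<open>t^2 = t + 1\<close>, so the
    upper bound on \<open>\<phi>\<close> yields \<open>\<rho> >= 1\<close>.\<close>
  have "(2 * \<phi> - 1)\<^sup>2 \<le> (sqrt 5)\<^sup>2"
    using phi by (intro power_mono) auto
  then have "\<phi>\<^sup>2 \<le> \<phi> + 1"
    by (simp add: power2_eq_square algebra_simps)
  then have \<rho>: "1 \<le> \<rho>"
    using phi unfolding rho by (simp add: field_simps power2_eq_square)
  have \<phi>\<rho>: "\<phi> * \<rho> = 1 + 1 / \<phi>"
    using phi unfolding rho by (simp add: field_simps power2_eq_square)

  \<comment> \<open>Positivity and upper bounds of the step sizes\<close>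
  have pos: "lam n > 0 \<and> \<theta> n > 0" for n
  proof (induction n)
    case 0
    then show ?case using lam0 theta0 by simp
  next
    case (Suc n)
    note st = step_size_min[OF lam[of "Suc n"]]
    have "lam (Suc n) = \<rho> * lam n \<or> lam (Suc n) = lambar \<or>
        (norm (F (x (Suc n)) - F (x n)))\<^sup>2 > 0 \<and>
        lam (Suc n) = \<phi> * \<theta> n / (4 * lam n) *
          ((norm (x (Suc n) - x n))\<^sup>2 / (norm (F (x (Suc n)) - F (x n)))\<^sup>2)"
      using st(4) Suc phi by simp
    \<comment> \<open>Different values of \<open>F\<close> force different iterates, so the quotient
      is positive when it determines the minimum.\<close>
    moreover have "(norm (x (Suc n) - x n))\<^sup>2 > 0" if "(norm (F (x (Suc n)) - F (x n)))\<^sup>2 > 0"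
      using that by auto
    ultimately have "lam (Suc n) > 0"
      using Suc \<rho> lambar phi by (elim disjE) auto
    then show ?case
      using Suc theta[of "Suc n"] phi by simp
  qed
  then have lam_pos: "lam n > 0" and \<theta>_pos: "\<theta> n > 0" for n
    by auto
  have lam_min: "lam (Suc n) \<le> \<rho> * lam n" "lam (Suc n) \<le> lambar"
    "lam (Suc n) * (norm (F (x (Suc n)) - F (x n)))\<^sup>2
      \<le> \<phi> * \<theta> n / (4 * lam n) * (norm (x (Suc n) - x n))\<^sup>2"
    "lam (Suc n) = \<rho> * lam n \<or> lam (Suc n) = lambar \<or>
      (norm (F (x (Suc n)) - F (x n)))\<^sup>2 > 0 \<and>
      lam (Suc n) = \<phi> * \<theta> n / (4 * lam n) *
        ((norm (x (Suc n) - x n))\<^sup>2 / (norm (F (x (Suc n)) - F (x n)))\<^sup>2)" for n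
    using step_size_min[OF lam[of "Suc n"]] lam_pos \<theta>_pos phi by simp_all
  have \<theta>_Suc: "\<theta> (Suc n) = \<phi> * (lam (Suc n) / lam n)" for n
    using theta[of "Suc n"] by simp
  have \<theta>_le: "\<theta> (Suc n) \<le> 1 + 1 / \<phi>" for n
  proof -
    have "lam (Suc n) / lam n \<le> \<rho>"
      using lam_min(1)[of n] lam_pos[of n] by (simp add: divide_le_eq)
    then show ?thesis
      unfolding \<theta>_Suc \<phi>\<rho>[symmetric] using phi by (intro mult_left_mono) auto
  qed

  \<comment> \<open>The recursion and its decreasing energy\<close>
  have xbar_Suc: "xbar (Suc n) = ((\<phi> - 1) *\<^sub>R x (Suc n) + xbar n) /\<^sub>R \<phi>" for n
    using xbar[of "Suc n"] by simp
  have gap: "x (Suc n) - xbar n = \<phi> *\<^sub>R (x (Suc n) - xbar (Suc n))" for n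
    using phi by (simp add: xbar_Suc algebra_simps)
  have x_step: "x (Suc (Suc n)) = xbar (Suc n) - lam (Suc n) *\<^sub>R F (x (Suc n))" for n
  proof -
    have "xbar (Suc n) = ((\<phi> - 1) / \<phi>) *\<^sub>R x (Suc n) + (1 / \<phi>) *\<^sub>R xbar n"
      by (simp add: xbar_Suc scaleR_add_right divide_inverse mult.commute)
    then show ?thesis
      using x[of "Suc n"] by (simp add: F scaleR_diff_left scaleR_diff_right)
  qed

  define E where "E z n = \<phi> / (\<phi> - 1) * (norm (xbar (n + 2) - z))\<^sup>2
      + \<theta> (n + 1) / 2 * (norm (x (n + 2) - x (n + 1)))\<^sup>2" for z n
  have E_nonneg: "E z n \<ge> 0" for z n
    using phi \<theta>_pos[of "n + 1"] by (simp add: E_def)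
  have desc: "E z (Suc n) + \<theta> (n + 2) * (norm (x (n + 2) - xbar (n + 2)))\<^sup>2 \<le> E z n"
    if z: "z \<in> Fix T" for z n
  proof -
    let ?k = "Suc n"
    \<comment> \<open>Multiplying the third bound of the rule by the new step size turns its
      coefficient into the product of two consecutive \<open>\<theta>\<close> over 4, as
      \<open>golden_ratio_step\<close> requires.\<close>
    have "(lam (Suc ?k))\<^sup>2 * (norm (F (x (Suc ?k)) - F (x ?k)))\<^sup>2
        \<le> lam (Suc ?k) * (\<phi> * \<theta> ?k / (4 * lam ?k) * (norm (x (Suc ?k) - x ?k))\<^sup>2)"
      using mult_left_mono[OF lam_min(3)[of ?k], of "lam (Suc ?k)"] lam_pos[of "Suc ?k"]
      by (simp add: power2_eq_square mult.assoc)
    also have "\<dots> = \<theta> (Suc ?k) * \<theta> ?k / 4 * (norm (x (Suc ?k) - x ?k))\<^sup>2"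
      by (simp add: \<theta>_Suc[of ?k] mult.commute mult.left_commute)
    finally have lip: "(lam (Suc ?k))\<^sup>2 * (norm (F (x (Suc ?k)) - F (x ?k)))\<^sup>2 \<le> \<dots>" .
    have v: "\<phi> *\<^sub>R (x (Suc ?k) - xbar (Suc ?k)) = - (lam ?k *\<^sub>R F (x ?k))"
      unfolding gap[symmetric] by (simp add: x_step)
    have "F (x (Suc ?k)) \<bullet> (x (Suc ?k) - z) \<ge> 0"
      using demi_contractive_inner_nonneg[OF demi z] F by simp
    from golden_ratio_step[OF phi(1) lam_pos lam_pos x_step v xbar_Suc \<theta>_Suc \<theta>_le \<theta>_pos lip this]
    show ?thesis
      by (simp add: E_def)
  qed
  have E_decseq: "decseq (E z)" if "z \<in> Fix T" for z
    using desc[OF that] \<theta>_pos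
    by (intro decseq_SucI) (smt (verit) mult_nonneg_nonneg zero_le_power2)
  have E_conv: "convergent (E z)" if "z \<in> Fix T" for z
    using decseq_convergent[OF E_decseq[OF that], of 0] E_nonneg by (metis convergentI)

  \<comment> \<open>Boundedness of the iterates and a uniform Lipschitz constant\<close>
  have "bounded (range xbar)"
  proof -
    have "norm (xbar (n + 2) - z0) \<le> sqrt ((\<phi> - 1) / \<phi> * E z0 0)" for n
    proof (rule real_le_rsqrt)
      have "\<phi> / (\<phi> - 1) * (norm (xbar (n + 2) - z0))\<^sup>2 \<le> E z0 n"
        using \<theta>_pos[of "n + 1"] by (simp add: E_def)
      also have "E z0 n \<le> E z0 0"
        using E_decseq[OF z0] by (simp add: decseq_def)
      finally show "(norm (xbar (n + 2) - z0))\<^sup>2 \<le> (\<phi> - 1) / \<phi> * E z0 0"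
        using phi by (simp add: field_simps)
    qed
    then have "range (\<lambda>n. xbar (n + 2)) \<subseteq> cball z0 (sqrt ((\<phi> - 1) / \<phi> * E z0 0))"
      by (auto simp: dist_norm norm_minus_commute)
    then have "Bseq (\<lambda>n. xbar (n + 2))"
      unfolding Bseq_eq_bounded by (rule bounded_subset[OF bounded_cball])
    then show ?thesis
      unfolding Bseq_eq_bounded[symmetric] by (rule Bseq_offset)
  qed
  then obtain M where M: "\<And>n. norm (xbar n) \<le> M"
    unfolding bounded_iff by auto
  \<comment> \<open>Solving the averaging rule for \<open>x (Suc n)\<close> bounds
    \<open>(\<phi> - 1) * norm (x (Suc n))\<close> by \<open>\<phi> * M + M\<close>, which is at
    most \<open>2 * \<phi> * M\<close>.\<close>
  define R where "R = 2 * \<phi> * M / (\<phi> - 1)"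
  have x_bound: "norm (x (Suc n)) \<le> R" for n
  proof -
    have "(\<phi> - 1) *\<^sub>R x (Suc n) = \<phi> *\<^sub>R xbar (Suc n) - xbar n"
      using phi by (simp add: xbar_Suc)
    then have "(\<phi> - 1) * norm (x (Suc n)) = norm (\<phi> *\<^sub>R xbar (Suc n) - xbar n)"
      using phi by (metis abs_of_pos diff_gt_0_iff_gt norm_scaleR)
    also have "\<dots> \<le> \<phi> * norm (xbar (Suc n)) + norm (xbar n)"
      using norm_triangle_ineq4[of "\<phi> *\<^sub>R xbar (Suc n)" "xbar n"] phi by simp
    also have "\<dots> \<le> \<phi> * M + \<phi> * M"
    proof (intro add_mono)
      show "\<phi> * norm (xbar (Suc n)) \<le> \<phi> * M"
        using M phi by simp
      have "1 * norm (xbar n) \<le> \<phi> * M"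
        using M phi by (intro mult_mono) auto
      then show "norm (xbar n) \<le> \<phi> * M" by simp
    qed
    finally show ?thesis
      using phi by (simp add: R_def field_simps)
  qed
  have K: "compact (cball (0::'a) R)"
    by (rule finite_dim_compact_cball[OF fin_dim])
  have x_in: "x (Suc n) \<in> cball 0 R" for n
    using x_bound by simp
  obtain L where L: "L-lipschitz_on (cball 0 R) T"
    using locally_lipschitz_compact_imp_lipschitz[OF lip K] .
  then have L0: "L \<ge> 0"
    by (rule lipschitz_on_nonneg)
  have F_lip: "norm (F u - F v) \<le> (1 + L) * norm (u - v)" if "u \<in> cball 0 R" "v \<in> cball 0 R" for u v
  proof -
    have "norm (F u - F v) \<le> norm (u - v) + norm (T u - T v)"
      using norm_triangle_ineq4[of "u - v" "T u - T v"] by (simp add: F algebra_simps)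
    also have "norm (T u - T v) \<le> L * norm (u - v)"
      using lipschitz_onD[OF L that] by (simp add: dist_norm)
    finally show ?thesis
      by (simp add: distrib_right)
  qed

  \<comment> \<open>Lower bounds for the step sizes\<close>
  define c where "c = \<phi>\<^sup>2 / (4 * lambar * (1 + L)\<^sup>2)"
  \<comment> \<open>\<open>c\<close> bounds the third term below:
    \<open>\<phi> * \<theta> (k - 1) / (4 * lam (k - 1))\<close> equals
    \<open>\<phi>^2 / (4 * lam (k - 2))\<close>, and \<open>lam (k - 2) <= lambar\<close> is
    available once \<open>k >= 3\<close>. Since \<open>lam 0\<close> may exceed
    \<open>lambar\<close>, the induction starts at \<open>lam 2\<close>.\<close>
  define m where "m = min (lam 2) (min lambar c)"
  have m_pos: "m > 0"
    using lam_pos lambar phi L0 by (simp add: m_def c_def)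
  have lam_ge: "lam (n + 2) \<ge> m" for n
  proof (induction n)
    case 0
    then show ?case by (simp add: m_def numeral_2_eq_2)
  next
    case (Suc n)
    let ?k = "Suc (Suc n)"
    consider "lam (Suc ?k) = \<rho> * lam ?k" | "lam (Suc ?k) = lambar"
      | "(norm (F (x (Suc ?k)) - F (x ?k)))\<^sup>2 > 0"
        "lam (Suc ?k) = \<phi> * \<theta> ?k / (4 * lam ?k) *
          ((norm (x (Suc ?k) - x ?k))\<^sup>2 / (norm (F (x (Suc ?k)) - F (x ?k)))\<^sup>2)"
      using lam_min(4)[of ?k] by blast
    then have "lam (Suc ?k) \<ge> m"
    proof cases
      case 1
      then have "lam ?k \<le> lam (Suc ?k)"
        using \<rho> lam_pos[of ?k] by simp
      then show ?thesis using Suc by simp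
    next
      case 2
      then show ?thesis by (simp add: m_def)
    next
      case 3
      have "\<phi> * \<theta> ?k / (4 * lam ?k) = \<phi>\<^sup>2 / (4 * lam (Suc n))"
        using lam_pos[of ?k] by (simp add: \<theta>_Suc[of "Suc n"] power2_eq_square)
      also have "\<dots> \<ge> \<phi>\<^sup>2 / (4 * lambar)"
        using lam_min(2)[of n] lam_pos[of "Suc n"] phi by (intro divide_left_mono) auto
      finally have 1: "\<phi>\<^sup>2 / (4 * lambar) \<le> \<phi> * \<theta> ?k / (4 * lam ?k)" .
      have "(norm (F (x (Suc ?k)) - F (x ?k)))\<^sup>2 \<le> (1 + L)\<^sup>2 * (norm (x (Suc ?k) - x ?k))\<^sup>2"
        using power_mono[OF F_lip[OF x_in x_in] norm_ge_zero, of ?k "Suc n" 2] by (simp add: power_mult_distrib)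
      then have 2: "1 / (1 + L)\<^sup>2
          \<le> (norm (x (Suc ?k) - x ?k))\<^sup>2 / (norm (F (x (Suc ?k)) - F (x ?k)))\<^sup>2"
        using 3(1) L0 by (simp add: divide_simps mult.commute)
      have "c = \<phi>\<^sup>2 / (4 * lambar) * (1 / (1 + L)\<^sup>2)"
        by (simp add: c_def)
      also have "\<dots> \<le> lam (Suc ?k)"
        unfolding 3(2) using 1 2 lambar lam_pos[of ?k] \<theta>_pos[of ?k] phi
        by (intro mult_mono) auto
      finally show ?thesis by (simp add: m_def)
    qed
    then show ?case by simp
  qed
  define t where "t = \<phi> * (m / lambar)"
  have t_pos: "t > 0"
    using phi m_pos lambar by (simp add: t_def)
  have \<theta>_ge: "t \<le> \<theta> (n + 2)" for n
  proof -
    have "m / lambar \<le> lam (Suc (Suc n)) / lam (Suc n)"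
      using lam_ge[of n] lam_min(2)[of n] m_pos lam_pos[of "Suc n"] by (intro frac_le) auto
    then show ?thesis
      using mult_left_mono[of "m / lambar" "lam (Suc (Suc n)) / lam (Suc n)" \<phi>] phi
      by (simp add: t_def \<theta>_Suc)
  qed

  \<comment> \<open>Vanishing gaps and residuals\<close>
  have gap0: "(\<lambda>n. x (n + 2) - xbar (n + 2)) \<longlonglongrightarrow> 0"
  proof -
    obtain l where l: "E z0 \<longlonglongrightarrow> l"
      using E_conv[OF z0] by (auto simp: convergent_def)
    have "(\<lambda>n. (E z0 n - E z0 (Suc n)) / t) \<longlonglongrightarrow> (l - l) / t"
      using t_pos by (intro tendsto_divide tendsto_diff l LIMSEQ_Suc[OF l] tendsto_const) auto
    then have lim: "(\<lambda>n. (E z0 n - E z0 (Suc n)) / t) \<longlonglongrightarrow> 0"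
      by simp
    \<comment> \<open>The energy drop dominates \<open>t\<close> times the squared gap, and the
      drops tend to 0 because the energy converges.\<close>
    have "(norm (x (n + 2) - xbar (n + 2)))\<^sup>2 \<le> (E z0 n - E z0 (Suc n)) / t" for n
    proof -
      have "t * (norm (x (n + 2) - xbar (n + 2)))\<^sup>2 \<le> \<theta> (n + 2) * (norm (x (n + 2) - xbar (n + 2)))\<^sup>2"
        using \<theta>_ge by (intro mult_right_mono) auto
      then show ?thesis
        using desc[OF z0, of n] t_pos by (simp add: pos_le_divide_eq mult.commute)
    qed
    then have "(\<lambda>n. (norm (x (n + 2) - xbar (n + 2)))\<^sup>2) \<longlonglongrightarrow> 0"
      by (intro tendsto_sandwich[OF _ _ tendsto_const[of 0] lim] always_eventually allI) simp_all
    then have "(\<lambda>n. norm (x (n + 2) - xbar (n + 2))) \<longlonglongrightarrow> 0"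
      using tendsto_real_sqrt[of "\<lambda>n. (norm (x (n + 2) - xbar (n + 2)))\<^sup>2" 0] by simp
    then show ?thesis
      by (rule tendsto_norm_zero_cancel)
  qed
  have next0: "(\<lambda>n. x (Suc (n + 2)) - xbar (n + 2)) \<longlonglongrightarrow> 0"
    using tendsto_scaleR[OF tendsto_const[of \<phi>] LIMSEQ_Suc[OF gap0]] by (simp add: gap)
  have F0: "(\<lambda>n. F (x (n + 2))) \<longlonglongrightarrow> 0"
  proof (rule Lim_null_comparison)
    have "norm (F (x (n + 2))) \<le> norm (x (Suc (n + 2)) - xbar (n + 2)) / m" for n
    proof -
      have "norm (x (Suc (n + 2)) - xbar (n + 2)) = lam (n + 2) * norm (F (x (n + 2)))"
        using x_step[of "Suc n"] lam_pos[of "n + 2"] by simp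
      moreover have "m * norm (F (x (n + 2))) \<le> lam (n + 2) * norm (F (x (n + 2)))"
        using lam_ge by (intro mult_right_mono) auto
      ultimately show ?thesis
        using m_pos by (simp add: pos_le_divide_eq mult.commute)
    qed
    then show "\<forall>\<^sub>F n in sequentially.
        norm (F (x (n + 2))) \<le> norm (x (Suc (n + 2)) - xbar (n + 2)) / m"
      by simp
    show "(\<lambda>n. norm (x (Suc (n + 2)) - xbar (n + 2)) / m) \<longlonglongrightarrow> 0"
      using tendsto_divide[OF tendsto_norm_zero[OF next0] tendsto_const[of m]] m_pos by simp
  qed

  \<comment> \<open>A cluster point and convergence of the whole sequence\<close>
  obtain p s where p: "p \<in> cball 0 R" and s: "strict_mono s"
    and xs: "((\<lambda>n. x (n + 2)) \<circ> s) \<longlonglongrightarrow> p"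
    using K x_in unfolding compact_def by (metis add_2_eq_Suc')
  have Fs: "(\<lambda>n. F (x (s n + 2))) \<longlonglongrightarrow> 0"
    using LIMSEQ_subseq_LIMSEQ[OF F0 s] by (simp add: o_def)
  have "continuous_on (cball 0 R) T"
    using L by (rule lipschitz_on_continuous_on)
  then have "(\<lambda>n. T (x (s n + 2))) \<longlonglongrightarrow> T p"
    using xs x_in p by (intro continuous_on_tendsto_compose[of _ T]) (auto simp: o_def)
  then have "(\<lambda>n. F (x (s n + 2))) \<longlonglongrightarrow> p - T p"
    unfolding F using xs by (intro tendsto_diff) (auto simp: o_def)
  then have "p - T p = 0"
    using Fs LIMSEQ_unique by blast
  then have p_fix: "p \<in> Fix T"
    by (simp add: Fix_def)

  have diff0: "(\<lambda>n. x (Suc (n + 2)) - x (n + 2)) \<longlonglongrightarrow> 0"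
    using tendsto_diff[OF next0 gap0] by simp
  have "(\<lambda>n. \<theta> (Suc n + 1) / 2 * (norm (x (Suc (n + 2)) - x (n + 2)))\<^sup>2) \<longlonglongrightarrow> 0"
  proof (rule tendsto_sandwich[OF _ _ tendsto_const[of 0]])
    show "\<forall>\<^sub>F n in sequentially. \<theta> (Suc n + 1) / 2 * (norm (x (Suc (n + 2)) - x (n + 2)))\<^sup>2
        \<le> (1 + 1 / \<phi>) / 2 * (norm (x (Suc (n + 2)) - x (n + 2)))\<^sup>2"
      using \<theta>_le by (intro always_eventually allI mult_right_mono) auto
    show "\<forall>\<^sub>F n in sequentially. 0 \<le> \<theta> (Suc n + 1) / 2 * (norm (x (Suc (n + 2)) - x (n + 2)))\<^sup>2"
      using \<theta>_pos by (intro always_eventually allI mult_nonneg_nonneg) (auto simp: less_imp_le)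
    show "(\<lambda>n. (1 + 1 / \<phi>) / 2 * (norm (x (Suc (n + 2)) - x (n + 2)))\<^sup>2) \<longlonglongrightarrow> 0"
      by (intro tendsto_mult_right_zero tendsto_null_power tendsto_norm_zero diff0) auto
  qed
  \<comment> \<open>Undoes the index shift, which was made because the differences are controlled
    only from \<open>x 3 - x 2\<close> on.\<close>
  then have "(\<lambda>n. \<theta> (n + 1) / 2 * (norm (x (n + 2) - x (n + 1)))\<^sup>2) \<longlonglongrightarrow> 0"
    by (intro LIMSEQ_imp_Suc[of "\<lambda>n. \<theta> (n + 1) / 2 * (norm (x (n + 2) - x (n + 1)))\<^sup>2"]) simp
  from LIMSEQ_subseq_LIMSEQ[OF this s]
  have \<theta>s: "(\<lambda>n. \<theta> (s n + 1) / 2 * (norm (x (s n + 2) - x (s n + 1)))\<^sup>2) \<longlonglongrightarrow> 0"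
    by (simp add: o_def)
  have "(\<lambda>n. x (s n + 2) - (x (s n + 2) - xbar (s n + 2))) \<longlonglongrightarrow> p - 0"
    using xs LIMSEQ_subseq_LIMSEQ[OF gap0 s] by (intro tendsto_diff) (auto simp: o_def)
  then have "(\<lambda>n. xbar (s n + 2) - p) \<longlonglongrightarrow> 0"
    by (simp add: LIM_zero_iff)
  then have "(\<lambda>n. \<phi> / (\<phi> - 1) * (norm (xbar (s n + 2) - p))\<^sup>2) \<longlonglongrightarrow> 0"
    by (intro tendsto_mult_right_zero tendsto_null_power tendsto_norm_zero) auto
  from tendsto_add[OF this \<theta>s] have "(E p \<circ> s) \<longlonglongrightarrow> 0"
    by (simp add: E_def o_def)
  \<comment> \<open>The energy for \<open>p\<close> converges as a whole, so its limit is the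
    subsequential limit 0.\<close>
  then have E0: "E p \<longlonglongrightarrow> 0"
    using E_conv[OF p_fix] s by (metis LIMSEQ_subseq_LIMSEQ LIMSEQ_unique convergent_def)
  have "(\<lambda>n. (norm (xbar (n + 2) - p))\<^sup>2) \<longlonglongrightarrow> 0"
  proof (rule tendsto_sandwich[OF _ _ tendsto_const[of 0] E0])
    \<comment> \<open>\<open>\<phi> / (\<phi> - 1)\<close> exceeds 1, so the energy dominates the
      squared distance of \<open>xbar\<close> to \<open>p\<close>.\<close>
    have "1 * (norm (xbar (n + 2) - p))\<^sup>2 \<le> \<phi> / (\<phi> - 1) * (norm (xbar (n + 2) - p))\<^sup>2" for n
      using phi by (intro mult_right_mono) auto
    then show "\<forall>\<^sub>F n in sequentially. (norm (xbar (n + 2) - p))\<^sup>2 \<le> E p n"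
      using \<theta>_pos by (intro always_eventually allI) (simp add: E_def add_increasing2 less_imp_le)
  qed auto
  then have "(\<lambda>n. norm (xbar (n + 2) - p)) \<longlonglongrightarrow> 0"
    using tendsto_real_sqrt[of "\<lambda>n. (norm (xbar (n + 2) - p))\<^sup>2" 0] by simp
  then have "(\<lambda>n. xbar (n + 2) - p) \<longlonglongrightarrow> 0"
    by (rule tendsto_norm_zero_cancel)
  from tendsto_add[OF gap0 this] have "(\<lambda>n. x (n + 2)) \<longlonglongrightarrow> p"
    by (simp add: LIM_zero_iff)
  then have "x \<longlonglongrightarrow> p"
    by (rule LIMSEQ_offset)
  with p_fix show ?thesis
    by blast
qed

end
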